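(* Suppose $2^{\aleph_0} \geq \aleph_2$. Then the Keisler criterion fails; that is, the following statement is false: for every countable first-order language $\mathcal{L}$ and any two $\mathcal{L}$-structures $\mathbf{M}, \mathbf{N}$ of size $\leq 2^{\aleph_0}$, $\mathbf{M} \equiv \mathbf{N}$ if and only if there exists an ultrafilter $\mathcal{U}$ on $\omega$ such that $\mathbf{M}^{\omega}/\mathcal{U} \simeq \mathbf{N}^{\omega}/\mathcal{U}$.
   Context: The ambient theory is ZFC. The size of a structure is the cardinality of its universe. $\mathbf{M} \equiv \mathbf{N}$ denotes elementary equivalence (the two structures satisfy the same first-order sentences of their common language), $\mathbf{M}^{\omega}/\mathcal{U}$ denotes the ultrapower of $\mathbf{M}$ by the ultrafilter $\mathcal{U}$ on $\omega$, and $\simeq$ denotes isomorphism of structures. *)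

theory Defs
  imports Main "HOL-Library.Countable_Set"
begin

unbundle cardinal_syntax

section \<open>First-order languages and their formulas\<close>

text \<open>
  Function and relation symbols may have any finite arity, 0 included (constants are function
  symbols of arity 0). Equality is a logical symbol and not a member of the language.
\<close>

record ('f, 'r) language =
  Funs :: "'f set"
  Rels :: "'r set"
  fun_arity :: "'f \<Rightarrow> nat"
  rel_arity :: "'r \<Rightarrow> nat"

definition countable_language :: "('f, 'r) language \<Rightarrow> bool" where
  "countable_language L \<longleftrightarrow> countable (Funs L) \<and> countable (Rels L)"

datatype 'f trm = Var nat | Fn 'f "'f trm list"

datatype ('f, 'r) fm =
    Eql "'f trm" "'f trm"
  | Rel 'r "'f trm list"
  | Neg "('f, 'r) fm"
  | Conj "('f, 'r) fm" "('f, 'r) fm"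
  | Exi nat "('f, 'r) fm"

fun wf_trm :: "('f, 'r) language \<Rightarrow> 'f trm \<Rightarrow> bool" where
  "wf_trm L (Var n) \<longleftrightarrow> True"
| "wf_trm L (Fn f ts) \<longleftrightarrow> f \<in> Funs L \<and> length ts = fun_arity L f \<and> (\<forall>t \<in> set ts. wf_trm L t)"

fun wf_fm :: "('f, 'r) language \<Rightarrow> ('f, 'r) fm \<Rightarrow> bool" where
  "wf_fm L (Eql s t) \<longleftrightarrow> wf_trm L s \<and> wf_trm L t"
| "wf_fm L (Rel r ts) \<longleftrightarrow> r \<in> Rels L \<and> length ts = rel_arity L r \<and> (\<forall>t \<in> set ts. wf_trm L t)"
| "wf_fm L (Neg p) \<longleftrightarrow> wf_fm L p"
| "wf_fm L (Conj p q) \<longleftrightarrow> wf_fm L p \<and> wf_fm L q"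
| "wf_fm L (Exi n p) \<longleftrightarrow> wf_fm L p"

fun fv_trm :: "'f trm \<Rightarrow> nat set" where
  "fv_trm (Var n) = {n}"
| "fv_trm (Fn f ts) = (\<Union>t \<in> set ts. fv_trm t)"

fun fv_fm :: "('f, 'r) fm \<Rightarrow> nat set" where
  "fv_fm (Eql s t) = fv_trm s \<union> fv_trm t"
| "fv_fm (Rel r ts) = (\<Union>t \<in> set ts. fv_trm t)"
| "fv_fm (Neg p) = fv_fm p"
| "fv_fm (Conj p q) = fv_fm p \<union> fv_fm q"
| "fv_fm (Exi n p) = fv_fm p - {n}"

definition sentence :: "('f, 'r) language \<Rightarrow> ('f, 'r) fm \<Rightarrow> bool" where
  "sentence L p \<longleftrightarrow> wf_fm L p \<and> fv_fm p = {}"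


section \<open>Structures, satisfaction and elementary equivalence\<close>

text \<open>
  The interpretations are total functions on lists; only their values on lists over the universe,
  of the length prescribed by the arity, are ever relevant.
\<close>

record ('a, 'f, 'r) struct =
  universe :: "'a set"
  fun_int :: "'f \<Rightarrow> 'a list \<Rightarrow> 'a"
  rel_int :: "'r \<Rightarrow> 'a list \<Rightarrow> bool"

definition is_struct :: "('f, 'r) language \<Rightarrow> ('a, 'f, 'r) struct \<Rightarrow> bool" where
  "is_struct L M \<longleftrightarrow> universe M \<noteq> {} \<and>
     (\<forall>f \<in> Funs L. \<forall>xs \<in> lists (universe M). length xs = fun_arity L f \<longrightarrow> fun_int M f xs \<in> universe M)"

fun eval_trm :: "('a, 'f, 'r) struct \<Rightarrow> (nat \<Rightarrow> 'a) \<Rightarrow> 'f trm \<Rightarrow> 'a" where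
  "eval_trm M s (Var n) = s n"
| "eval_trm M s (Fn f ts) = fun_int M f (map (eval_trm M s) ts)"

fun sat :: "('a, 'f, 'r) struct \<Rightarrow> (nat \<Rightarrow> 'a) \<Rightarrow> ('f, 'r) fm \<Rightarrow> bool" where
  "sat M s (Eql t u) \<longleftrightarrow> eval_trm M s t = eval_trm M s u"
| "sat M s (Rel r ts) \<longleftrightarrow> rel_int M r (map (eval_trm M s) ts)"
| "sat M s (Neg p) \<longleftrightarrow> \<not> sat M s p"
| "sat M s (Conj p q) \<longleftrightarrow> sat M s p \<and> sat M s q"
| "sat M s (Exi n p) \<longleftrightarrow> (\<exists>a \<in> universe M. sat M (s(n := a)) p)"

definition models :: "('a, 'f, 'r) struct \<Rightarrow> ('f, 'r) fm \<Rightarrow> bool" where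
  "models M p \<longleftrightarrow> (\<forall>s. range s \<subseteq> universe M \<longrightarrow> sat M s p)"

definition elem_equiv ::
  "('f, 'r) language \<Rightarrow> ('a, 'f, 'r) struct \<Rightarrow> ('b, 'f, 'r) struct \<Rightarrow> bool" where
  "elem_equiv L M N \<longleftrightarrow> (\<forall>p. sentence L p \<longrightarrow> (models M p \<longleftrightarrow> models N p))"

definition isomorphic ::
  "('f, 'r) language \<Rightarrow> ('a, 'f, 'r) struct \<Rightarrow> ('b, 'f, 'r) struct \<Rightarrow> bool" where
  "isomorphic L M N \<longleftrightarrow> (\<exists>h. bij_betw h (universe M) (universe N) \<and>
     (\<forall>f \<in> Funs L. \<forall>xs \<in> lists (universe M). length xs = fun_arity L f \<longrightarrow>
        h (fun_int M f xs) = fun_int N f (map h xs)) \<and>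
     (\<forall>r \<in> Rels L. \<forall>xs \<in> lists (universe M). length xs = rel_arity L r \<longrightarrow>
        (rel_int M r xs \<longleftrightarrow> rel_int N r (map h xs))))"


section \<open>Ultrapowers\<close>

text \<open>
  A set \<open>A\<close> of indices belongs to the filter \<open>U\<close> iff \<open>eventually (\<lambda>i. i \<in> A) U\<close>. The definition is
  that of HOL-Nonstandard_Analysis. Principal ultrafilters are included.
\<close>

definition ultrafilter :: "'i filter \<Rightarrow> bool" where
  "ultrafilter U \<longleftrightarrow> U \<noteq> bot \<and> (\<forall>P. eventually P U \<or> eventually (\<lambda>i. \<not> P i) U)"

definition up_rel :: "'i filter \<Rightarrow> 'a set \<Rightarrow> (('i \<Rightarrow> 'a) \<times> ('i \<Rightarrow> 'a)) set" where
  "up_rel U A = {(x, y). range x \<subseteq> A \<and> range y \<subseteq> A \<and> eventually (\<lambda>i. x i = y i) U}"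

text \<open>
  The elements of the ultrapower are the equivalence classes of sequences. In both interpretations
  \<open>xs\<close> runs through all lists of representatives of the classes in \<open>Xs\<close>, and
  \<open>map (\<lambda>x. x i) xs\<close> is the list of their \<open>i\<close>-th coordinates.
\<close>

definition ultrapower ::
  "('a, 'f, 'r) struct \<Rightarrow> 'i filter \<Rightarrow> (('i \<Rightarrow> 'a) set, 'f, 'r) struct" where
  "ultrapower M U =
    \<lparr> universe = {x. range x \<subseteq> universe M} // up_rel U (universe M),
      fun_int = (\<lambda>f Xs. up_rel U (universe M) ``
        {\<lambda>i. fun_int M f (map (\<lambda>x. x i) xs) | xs. list_all2 (\<in>) xs Xs}),
      rel_int = (\<lambda>r Xs. \<exists>xs. list_all2 (\<in>) xs Xs \<and>
        eventually (\<lambda>i. rel_int M r (map (\<lambda>x. x i) xs)) U) \<rparr>"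

text \<open>
  The interpretations do not depend on the representatives; this needs only that \<open>U\<close> is a filter.
\<close>

lemma equiv_up_rel: "equiv {x. range x \<subseteq> A} (up_rel U A)"
proof (rule equivI)
  show "up_rel U A \<subseteq> {x. range x \<subseteq> A} \<times> {x. range x \<subseteq> A}"
    by (auto simp: up_rel_def)
  show "refl_on {x. range x \<subseteq> A} (up_rel U A)"
    by (auto simp: refl_on_def up_rel_def)
  show "sym (up_rel U A)"
    by (auto simp: sym_def up_rel_def eq_commute)
  show "trans (up_rel U A)"
    by (auto simp: trans_def up_rel_def elim: eventually_elim2)
qed

lemma eventually_map_eq:
  assumes "list_all2 (\<lambda>x y. eventually (\<lambda>i. x i = y i) U) xs ys"
  shows "eventually (\<lambda>i. map (\<lambda>x. x i) xs = map (\<lambda>y. y i) ys) U"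
  using assms by (induction rule: list_all2_induct) (auto elim: eventually_elim2)

lemma representatives_eventually_eq:
  assumes "list_all2 (\<in>) xs (map (\<lambda>y. up_rel U A `` {y}) ys)"
  shows "eventually (\<lambda>i. map (\<lambda>x. x i) xs = map (\<lambda>y. y i) ys) U"
proof (rule eventually_map_eq)
  show "list_all2 (\<lambda>x y. eventually (\<lambda>i. x i = y i) U) xs ys"
    using assms by (auto simp: list_all2_conv_all_nth up_rel_def eq_commute)
qed

lemma representatives_self:
  assumes "\<And>y. y \<in> set ys \<Longrightarrow> range y \<subseteq> A"
  shows "list_all2 (\<in>) ys (map (\<lambda>y. up_rel U A `` {y}) ys)"
  using assms by (induction ys) (auto simp: up_rel_def)

lemma rel_int_ultrapower:
  assumes "\<And>y. y \<in> set ys \<Longrightarrow> range y \<subseteq> universe M"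
  shows "rel_int (ultrapower M U) r (map (\<lambda>y. up_rel U (universe M) `` {y}) ys) \<longleftrightarrow>
    eventually (\<lambda>i. rel_int M r (map (\<lambda>y. y i) ys)) U"
    (is "?L \<longleftrightarrow> ?R")
proof
  assume ?L
  then obtain xs where
    "list_all2 (\<in>) xs (map (\<lambda>y. up_rel U (universe M) `` {y}) ys)" and
    r: "eventually (\<lambda>i. rel_int M r (map (\<lambda>x. x i) xs)) U"
    by (auto simp: ultrapower_def)
  from this(1) have "eventually (\<lambda>i. map (\<lambda>x. x i) xs = map (\<lambda>y. y i) ys) U"
    by (rule representatives_eventually_eq)
  with r show ?R
    by (rule eventually_elim2) simp
next
  assume ?R
  then show ?L
    using representatives_self[of ys "universe M" U] assms by (auto simp: ultrapower_def)
qed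

lemma fun_int_ultrapower:
  assumes M: "is_struct L M" and f: "f \<in> Funs L" "length ys = fun_arity L f"
    and ys: "\<And>y. y \<in> set ys \<Longrightarrow> range y \<subseteq> universe M"
  shows "fun_int (ultrapower M U) f (map (\<lambda>y. up_rel U (universe M) `` {y}) ys) =
    up_rel U (universe M) `` {\<lambda>i. fun_int M f (map (\<lambda>y. y i) ys)}"
    (is "_ = ?E `` {?g ys}")
proof -
  let ?Ys = "map (\<lambda>y. ?E `` {y}) ys"
  have "?E `` {?g xs} = ?E `` {?g ys}" if xs: "list_all2 (\<in>) xs ?Ys" for xs
  proof (rule equiv_class_eq[OF equiv_up_rel])
    have closed: "range (?g zs) \<subseteq> universe M"
      if "length zs = fun_arity L f" "\<And>z. z \<in> set zs \<Longrightarrow> range z \<subseteq> universe M" for zs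
    proof -
      have "fun_int M f (map (\<lambda>z. z i) zs) \<in> universe M" for i
      proof -
        have "map (\<lambda>z. z i) zs \<in> lists (universe M)"
          using that(2) by (auto simp: lists_eq_set)
        then show ?thesis
          using M f(1) that(1) by (simp add: is_struct_def)
      qed
      then show ?thesis
        by blast
    qed
    have "range x \<subseteq> universe M" if x: "x \<in> set xs" for x
    proof -
      obtain i where "i < length xs" "x = xs ! i"
        using x by (auto simp: in_set_conv_nth)
      with xs have "(ys ! i, x) \<in> ?E"
        by (auto simp: list_all2_conv_all_nth)
      then show ?thesis
        by (simp add: up_rel_def)
    qed
    moreover have "length xs = fun_arity L f"
      using list_all2_lengthD[OF xs] f by simp
    moreover have "eventually (\<lambda>i. ?g xs i = ?g ys i) U"
      using representatives_eventually_eq[OF xs] by (rule eventually_mono) simp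
    ultimately show "(?g xs, ?g ys) \<in> ?E"
      using closed[of xs] closed[of ys] f ys by (simp add: up_rel_def)
  qed
  moreover have "list_all2 (\<in>) ys ?Ys"
    by (rule representatives_self) (rule ys)
  ultimately have "?E `` {?g xs | xs. list_all2 (\<in>) xs ?Ys} = ?E `` {?g ys}"
    by blast
  then show ?thesis
    by (simp add: ultrapower_def)
qed


section \<open>Conventions for the theorem\<close>

text \<open>
  \<open>ctwo ^c natLeq\<close> is the cardinal \<open>2\<close> to the \<open>\<aleph>\<^sub>0\<close>, and \<open>cardSuc (cardSuc natLeq)\<close> is \<open>\<aleph>\<^sub>2\<close>.

  Up to renaming, the symbols of a countable language are natural numbers. The universes of the
  structures are arbitrary subsets, of size at most \<open>ctwo ^c natLeq\<close>, of an ambient type \<open>'a\<close>. The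
  assumption \<open>ctwo ^c natLeq \<le>o |UNIV :: 'a set|\<close> is no hypothesis of the mathematical theorem: it
  says that, up to isomorphism, every structure of this size lives on some subset of \<open>'a\<close>. It holds
  e.g. for \<open>'a = nat set\<close>.
\<close>

end

theory Submission
  imports Defs Complex_Main "HOL-Library.Countable_Set_Type"
begin

text \<open>
  The lexicographic products \<open>\<omega>\<^sub>1 \<times> \<rat>\<close> and \<open>\<omega>\<^sub>2 \<times> \<rat>\<close> are dense linear orders without
  endpoints, hence elementarily equivalent, and both have size at most \<open>2\<close> to the \<open>\<aleph>\<^sub>0\<close>. Their
  cofinalities \<open>\<aleph>\<^sub>1\<close> and \<open>\<aleph>\<^sub>2\<close> are preserved by every ultrapower over \<open>\<omega>\<close>: the values of a
  sequence are bounded by a single element, because an uncountable regular cardinal has no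
  countable cofinal subset, so the diagonal image of a cofinal chain is cofinal. Hence an
  ultrapower of the first order is never isomorphic to an ultrapower of the second.
\<close>

section \<open>Dense linear orders without endpoints\<close>

text \<open>Transitivity and irreflexivity are global properties of \<open>r\<close>, totality is
  relative to \<open>A\<close>; so a pullback defined on the whole type can later serve as the
  order.\<close>

definition dense_order_on :: "'a set \<Rightarrow> 'a rel \<Rightarrow> bool" where
  "dense_order_on A r \<longleftrightarrow> A \<noteq> {} \<and> strict_linear_order_on A r \<and>
    (\<forall>x \<in> A. \<forall>y \<in> A. (x, y) \<in> r \<longrightarrow> (\<exists>z \<in> A. (x, z) \<in> r \<and> (z, y) \<in> r)) \<and>
    (\<forall>x \<in> A. (\<exists>y \<in> A. (y, x) \<in> r) \<and> (\<exists>y \<in> A. (x, y) \<in> r))"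

lemma dense_order_onD:
  assumes "dense_order_on A r"
  shows "A \<noteq> {}"
    and "\<And>x y z. (x, y) \<in> r \<Longrightarrow> (y, z) \<in> r \<Longrightarrow> (x, z) \<in> r"
    and "\<And>x. (x, x) \<notin> r"
    and "\<And>x y. x \<in> A \<Longrightarrow> y \<in> A \<Longrightarrow> (x, y) \<in> r \<or> x = y \<or> (y, x) \<in> r"
    and "\<And>x y. x \<in> A \<Longrightarrow> y \<in> A \<Longrightarrow> (x, y) \<in> r \<Longrightarrow> \<exists>z \<in> A. (x, z) \<in> r \<and> (z, y) \<in> r"
    and "\<And>x. x \<in> A \<Longrightarrow> \<exists>y \<in> A. (y, x) \<in> r"
    and "\<And>x. x \<in> A \<Longrightarrow> \<exists>y \<in> A. (x, y) \<in> r"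
  using assms
  unfolding dense_order_on_def strict_linear_order_on_def total_on_def irrefl_def trans_def
  by blast+

lemma strict_linear_order_on_converse:
  "strict_linear_order_on A r \<Longrightarrow> strict_linear_order_on A (r\<inverse>)"
  by (auto simp: strict_linear_order_on_def irrefl_def)

lemma finite_has_greatest:
  assumes "strict_linear_order_on A r" "finite X" "X \<noteq> {}" "X \<subseteq> A"
  shows "\<exists>m \<in> X. \<forall>x \<in> X. x = m \<or> (x, m) \<in> r"
  using assms(2-)
proof (induction X rule: finite_ne_induct)
  case (singleton x)
  then show ?case by simp
next
  case (insert x X)
  then obtain m where m: "m \<in> X" "\<forall>y \<in> X. y = m \<or> (y, m) \<in> r"
    by auto
  have tr: "trans r" and tot: "total_on A r"
    using assms(1) by (auto simp: strict_linear_order_on_def)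
  show ?case
  proof (cases "(m, x) \<in> r")
    case True
    then have "(y, x) \<in> r" if "y \<in> X" for y
      using True that m(2) transD[OF tr, of y m x] by auto
    then have "\<forall>y \<in> insert x X. y = x \<or> (y, x) \<in> r"
      by blast
    then show ?thesis by blast
  next
    case False
    with tot m(1) insert.prems have "x = m \<or> (x, m) \<in> r"
      unfolding total_on_def by blast
    with m show ?thesis by blast
  qed
qed

text \<open>The greatest point of \<open>X\<close> and the least point of \<open>Y\<close> represent
  these finite sets. Density separates the two; the absence of endpoints covers the cases with an
  empty side.\<close>

lemma dense_order_between:
  assumes A: "dense_order_on A r" and fin: "finite X" "finite Y" and sub: "X \<subseteq> A" "Y \<subseteq> A"
    and lt: "\<And>x y. x \<in> X \<Longrightarrow> y \<in> Y \<Longrightarrow> (x, y) \<in> r"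
  shows "\<exists>z \<in> A. (\<forall>x \<in> X. (x, z) \<in> r) \<and> (\<forall>y \<in> Y. (z, y) \<in> r)"
proof -
  note D = dense_order_onD[OF A]
  have lin: "strict_linear_order_on A r"
    using A by (simp add: dense_order_on_def)
  have max: "\<exists>m \<in> X. \<forall>x \<in> X. x = m \<or> (x, m) \<in> r" if "X \<noteq> {}"
    using finite_has_greatest[OF lin fin(1) that sub(1)] .
  have min: "\<exists>m \<in> Y. \<forall>y \<in> Y. y = m \<or> (m, y) \<in> r" if "Y \<noteq> {}"
    \<comment> \<open>A greatest element for the converse order is a least one.\<close>
    using finite_has_greatest[OF strict_linear_order_on_converse[OF lin] fin(2) that sub(2)]
    by simp
  consider "X = {}" "Y = {}" | "X = {}" "Y \<noteq> {}" | "X \<noteq> {}" "Y = {}" | "X \<noteq> {}" "Y \<noteq> {}"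
    by blast
  then show ?thesis
  proof cases
    case 1
    then show ?thesis using D(1) by auto
  next
    case 2
    obtain m where m: "m \<in> Y" "\<forall>y \<in> Y. y = m \<or> (m, y) \<in> r"
      using min 2 by blast
    with sub obtain z where "z \<in> A" "(z, m) \<in> r"
      using D(6) by blast
    moreover from this m have "\<forall>y \<in> Y. (z, y) \<in> r"
      using D(2) by metis
    ultimately show ?thesis using 2 by blast
  next
    case 3
    obtain m where m: "m \<in> X" "\<forall>x \<in> X. x = m \<or> (x, m) \<in> r"
      using max 3 by blast
    with sub obtain z where "z \<in> A" "(m, z) \<in> r"
      using D(7) by blast
    moreover from this m have "\<forall>x \<in> X. (x, z) \<in> r"
      using D(2) by metis
    ultimately show ?thesis using 3 by blast
  next
    case 4
    obtain m where m: "m \<in> X" "\<forall>x \<in> X. x = m \<or> (x, m) \<in> r"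
      using max 4 by blast
    obtain n where n: "n \<in> Y" "\<forall>y \<in> Y. y = n \<or> (n, y) \<in> r"
      using min 4 by blast
    obtain z where "z \<in> A" "(m, z) \<in> r" "(z, n) \<in> r"
      using D(5)[of m n] lt m(1) n(1) sub by blast
    moreover from this m n have "\<forall>x \<in> X. (x, z) \<in> r" "\<forall>y \<in> Y. (z, y) \<in> r"
      using D(2) by metis+
    ultimately show ?thesis by blast
  qed
qed

lemma dense_order_extend:
  assumes A: "dense_order_on A r" and B: "dense_order_on B q" and "finite V"
    and st: "s ` V \<subseteq> A" "t ` V \<subseteq> B"
    and iff: "\<And>i j. i \<in> V \<Longrightarrow> j \<in> V \<Longrightarrow> (s i, s j) \<in> r \<longleftrightarrow> (t i, t j) \<in> q"
    and a: "a \<in> A"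
  shows "\<exists>b \<in> B. \<forall>i \<in> V. ((s i, a) \<in> r \<longleftrightarrow> (t i, b) \<in> q) \<and> ((a, s i) \<in> r \<longleftrightarrow> (b, t i) \<in> q)"
proof (cases "a \<in> s ` V")
  case True
  then show ?thesis using iff st(2) by blast
next
  case False
  note D = dense_order_onD[OF A] and E = dense_order_onD[OF B]
  let ?X = "{i \<in> V. (s i, a) \<in> r}" and ?Y = "{i \<in> V. (a, s i) \<in> r}"
  have "\<exists>b \<in> B. (\<forall>x \<in> t ` ?X. (x, b) \<in> q) \<and> (\<forall>y \<in> t ` ?Y. (b, y) \<in> q)"
  proof (rule dense_order_between[OF B])
    show "(x, y) \<in> q" if "x \<in> t ` ?X" "y \<in> t ` ?Y" for x y
    proof -
      obtain i j where "i \<in> V" "j \<in> V" "x = t i" "y = t j" "(s i, a) \<in> r" "(a, s j) \<in> r"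
        using \<open>x \<in> t ` ?X\<close> \<open>y \<in> t ` ?Y\<close> by auto
      then show ?thesis
        using iff[of i j] D(2)[of "s i" a "s j"] by simp
    qed
  qed (use \<open>finite V\<close> st in auto)
  then obtain b where b: "b \<in> B" "\<forall>x \<in> t ` ?X. (x, b) \<in> q" "\<forall>y \<in> t ` ?Y. (b, y) \<in> q"
    by (elim bexE conjE)
  \<comment> \<open>The forward implications yield the equivalences: \<open>s i\<close> is on one
    side of \<open>a\<close>, and \<open>t i\<close> cannot be on both sides of
    \<open>b\<close>.\<close>
  have "(s i, a) \<in> r \<or> (a, s i) \<in> r" if "i \<in> V" for i
    using False D(4)[of "s i" a] a st that by auto
  moreover have "(s i, a) \<in> r \<longrightarrow> (t i, b) \<in> q" "(a, s i) \<in> r \<longrightarrow> (b, t i) \<in> q"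
    if "i \<in> V" for i
    using that b(2,3) by auto
  ultimately have "((s i, a) \<in> r \<longleftrightarrow> (t i, b) \<in> q) \<and> ((a, s i) \<in> r \<longleftrightarrow> (b, t i) \<in> q)"
    if "i \<in> V" for i
    using that D(2)[of "s i" a "s i"] D(3)[of "s i"]
      E(2)[of "t i" b "t i"] E(3)[of "t i"] by blast
  with b(1) show ?thesis by blast
qed

section \<open>Elementary equivalence of dense orders\<close>

definition order_language :: "('f, nat) language" where
  "order_language = \<lparr>Funs = {}, Rels = {0}, fun_arity = (\<lambda>_. 0), rel_arity = (\<lambda>_. 2)\<rparr>"

definition order_struct :: "'a set \<Rightarrow> 'a rel \<Rightarrow> ('a, 'f, nat) struct" where
  "order_struct A r =
    \<lparr>universe = A, fun_int = (\<lambda>_ _. undefined), rel_int = (\<lambda>_ xs. (xs ! 0, xs ! 1) \<in> r)\<rparr>"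

lemma order_language_simps [simp]:
  "Funs order_language = {}" "Rels order_language = {0}" "rel_arity order_language k = 2"
  by (simp_all add: order_language_def)

lemma order_struct_simps [simp]:
  "universe (order_struct A r) = A" "rel_int (order_struct A r) k [x, y] \<longleftrightarrow> (x, y) \<in> r"
  by (simp_all add: order_struct_def)

lemma wf_trm_order_language:
  "wf_trm order_language t \<longleftrightarrow> (\<exists>n. t = Var n)"
  by (cases t) auto

lemma finite_fv_trm: "finite (fv_trm t)"
  by (induction t) auto

lemma finite_fv_fm: "finite (fv_fm p)"
  by (induction p) (auto simp: finite_fv_trm)

text \<open>Back-and-forth as an induction on formulas, for varying assignments. Only the finitely
  many free variables are constrained, so the partial isomorphisms stay finite and a quantifier
  costs one use of \<open>dense_order_extend\<close>.\<close>

lemma sat_order_struct_iff: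
  fixes s :: "nat \<Rightarrow> 'a" and t :: "nat \<Rightarrow> 'b" and p :: "('f, nat) fm"
  assumes A: "dense_order_on A r" and B: "dense_order_on B q"
    and "wf_fm order_language p" "s ` fv_fm p \<subseteq> A" "t ` fv_fm p \<subseteq> B"
    and "\<And>i j. i \<in> fv_fm p \<Longrightarrow> j \<in> fv_fm p \<Longrightarrow> (s i, s j) \<in> r \<longleftrightarrow> (t i, t j) \<in> q"
  shows "sat (order_struct A r) s p \<longleftrightarrow> sat (order_struct B q) t p"
  using assms(3-)
proof (induction p arbitrary: s t)
  case (Eql u v)
  then obtain m n where uv: "u = Var m" "v = Var n"
    by (auto simp: wf_trm_order_language)
  with Eql have "s m \<in> A" "s n \<in> A" "t m \<in> B" "t n \<in> B"
    "(s m, s n) \<in> r \<longleftrightarrow> (t m, t n) \<in> q" "(s n, s m) \<in> r \<longleftrightarrow> (t n, t m) \<in> q"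
    by auto
  \<comment> \<open>In a strict linear order, equality is incomparability, so it is decided by the
    order alone.\<close>
  then have "s m = s n \<longleftrightarrow> t m = t n"
    using dense_order_onD(3,4)[OF A] dense_order_onD(3,4)[OF B] by metis
  with uv show ?case by simp
next
  case (Rel k ts)
  then obtain u v where "ts = [u, v]"
    by (auto simp: length_Suc_conv numeral_2_eq_2)
  with Rel obtain m n where "ts = [Var m, Var n]"
    by (auto simp: wf_trm_order_language)
  with Rel show ?case by simp
next
  case (Neg p)
  then show ?case by simp
next
  case (Conj p p')
  have "sat (order_struct A r) s p \<longleftrightarrow> sat (order_struct B q) t p"
    by (rule Conj.IH(1)) (use Conj.prems in auto)
  moreover have "sat (order_struct A r) s p' \<longleftrightarrow> sat (order_struct B q) t p'"
    by (rule Conj.IH(2)) (use Conj.prems in auto)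
  ultimately show ?case by simp
next
  case (Exi n p)
  let ?V = "fv_fm p - {n}"
  have fin: "finite ?V"
    by (simp add: finite_fv_fm)
  have st: "s ` ?V \<subseteq> A" "t ` ?V \<subseteq> B"
    and iff: "\<And>i j. i \<in> ?V \<Longrightarrow> j \<in> ?V \<Longrightarrow> (s i, s j) \<in> r \<longleftrightarrow> (t i, t j) \<in> q"
    using Exi.prems by auto
  have step: "sat (order_struct A r) (s(n := a)) p \<longleftrightarrow> sat (order_struct B q) (t(n := b)) p"
    if "a \<in> A" "b \<in> B"
      "\<forall>i \<in> ?V. ((s i, a) \<in> r \<longleftrightarrow> (t i, b) \<in> q) \<and> ((a, s i) \<in> r \<longleftrightarrow> (b, t i) \<in> q)" for a b
  proof (rule Exi.IH)
    \<comment> \<open>Irreflexivity settles the pair \<open>i = j = n\<close>; pairs with exactly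
      one index \<open>n\<close> are settled by the match between \<open>a\<close> and
      \<open>b\<close>.\<close>
    show "((s(n := a)) i, (s(n := a)) j) \<in> r \<longleftrightarrow> ((t(n := b)) i, (t(n := b)) j) \<in> q"
      if "i \<in> fv_fm p" "j \<in> fv_fm p" for i j
      using that \<open>\<forall>i \<in> ?V. _ i\<close> iff dense_order_onD(3)[OF A] dense_order_onD(3)[OF B] by auto
  qed (use that Exi.prems(1) st in auto)
  have "\<exists>b \<in> B. sat (order_struct B q) (t(n := b)) p"
    if "a \<in> A" "sat (order_struct A r) (s(n := a)) p" for a
    using dense_order_extend[OF A B fin st iff that(1)] step that by blast
  moreover have "\<exists>a \<in> A. sat (order_struct A r) (s(n := a)) p"
    if b: "b \<in> B" "sat (order_struct B q) (t(n := b)) p" for b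
  proof -
    have "\<exists>a \<in> A. \<forall>i \<in> ?V. ((t i, b) \<in> q \<longleftrightarrow> (s i, a) \<in> r) \<and> ((b, t i) \<in> q \<longleftrightarrow> (a, s i) \<in> r)"
      using dense_order_extend[OF B A fin st(2,1) _ b(1)] iff by simp
    with step b show ?thesis by blast
  qed
  ultimately show ?case by auto
qed

lemma elem_equiv_dense_orders:
  assumes A: "dense_order_on A r" and B: "dense_order_on B q"
  shows "elem_equiv order_language (order_struct A r) (order_struct B q)"
  unfolding elem_equiv_def
proof (intro allI impI)
  fix p :: "('f, nat) fm"
  assume p: "sentence order_language p"
  have iff: "sat (order_struct A r) s p \<longleftrightarrow> sat (order_struct B q) t p" for s t
    by (rule sat_order_struct_iff[OF A B]) (use p in \<open>auto simp: sentence_def\<close>)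
  \<comment> \<open>Truth in one structure reaches the other through some assignment into the first;
    constant assignments supply one on each side.\<close>
  obtain a b where "a \<in> A" "b \<in> B"
    using dense_order_onD(1)[OF A] dense_order_onD(1)[OF B] by blast
  then have "range (\<lambda>_ :: nat. a) \<subseteq> A" "range (\<lambda>_ :: nat. b) \<subseteq> B"
    by auto
  with iff show "models (order_struct A r) p \<longleftrightarrow> models (order_struct B q) p"
    unfolding models_def order_struct_simps by blast
qed

section \<open>Cofinal chains\<close>

text \<open>Asking for a bound from some index on takes the place of monotonicity of
  \<open>f\<close>: several such bounds merge at any common upper index.\<close>

definition cofinal_along :: "'i rel \<Rightarrow> 'a set \<Rightarrow> 'a rel \<Rightarrow> ('i \<Rightarrow> 'a) \<Rightarrow> bool" where
  "cofinal_along k A r f \<longleftrightarrow> f ` Field k \<subseteq> A \<and>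
    (\<forall>a \<in> A. \<exists>i \<in> Field k. \<forall>j. (i, j) \<in> k \<longrightarrow> (a, f j) \<in> r)"

lemma Card_orderD:
  assumes "Card_order k"
  shows "\<And>i. i \<in> Field k \<Longrightarrow> (i, i) \<in> k"
    and "\<And>i j l. (i, j) \<in> k \<Longrightarrow> (j, l) \<in> k \<Longrightarrow> (i, l) \<in> k"
    and "\<And>i j. i \<in> Field k \<Longrightarrow> j \<in> Field k \<Longrightarrow> (i, j) \<in> k \<or> (j, i) \<in> k"
proof -
  have "wo_rel k"
    using assms by (simp add: wo_rel_def card_order_on_def)
  then have "Refl k" "trans k" "Total k"
    by (rule wo_rel.REFL wo_rel.TRANS wo_rel.TOTAL)+
  then show "\<And>i. i \<in> Field k \<Longrightarrow> (i, i) \<in> k"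
    and "\<And>i j l. (i, j) \<in> k \<Longrightarrow> (j, l) \<in> k \<Longrightarrow> (i, l) \<in> k"
    by (auto simp: refl_on_def dest: transD)
  show "\<And>i j. i \<in> Field k \<Longrightarrow> j \<in> Field k \<Longrightarrow> (i, j) \<in> k \<or> (j, i) \<in> k"
    using \<open>Refl k\<close> \<open>Total k\<close> unfolding refl_on_def total_on_def by metis
qed

text \<open>A cofinal subset of a regular cardinal has full size, so \<open>X\<close> is not
  cofinal. As \<open>cofinal\<close> is a strict notion, the index that escapes \<open>X\<close> may
  itself belong to \<open>X\<close>; by totality it bounds \<open>X\<close> in the reflexive
  order.\<close>

lemma regularCard_bounded:
  assumes k: "Card_order k" "regularCard k" and X: "X \<subseteq> Field k" "|X| <o k"
  shows "\<exists>j \<in> Field k. \<forall>i \<in> X. (i, j) \<in> k"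
proof -
  have "\<not> cofinal X k"
    using k(2) X not_ordLess_ordIso[OF X(2)] by (auto simp: regularCard_def)
  then obtain j where "j \<in> Field k" "\<forall>i \<in> X. j = i \<or> (j, i) \<notin> k"
    by (auto simp: cofinal_def)
  moreover from this have "(i, j) \<in> k" if "i \<in> X" for i
    using X(1) that Card_orderD(1)[OF k(1), of j] Card_orderD(3)[OF k(1), of i j]
    by (metis subsetD)
  ultimately show ?thesis
    by blast
qed

text \<open>From some index \<open>b i\<close> on, \<open>g\<close> exceeds \<open>f i\<close>.
  These fewer than \<open>l\<close> indices have a common bound \<open>j\<close>, so
  \<open>g j\<close> exceeds every \<open>f i\<close>, while some \<open>f i\<close> exceeds
  \<open>g j\<close>. This contradicts asymmetry, the one order axiom that has to be transferred to
  ultrapowers.\<close>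

lemma no_cofinal_chains_of_distinct_length:
  assumes asym: "\<And>x y. x \<in> A \<Longrightarrow> y \<in> A \<Longrightarrow> (x, y) \<in> r \<Longrightarrow> (y, x) \<notin> r"
    and f: "cofinal_along k A r f" and g: "cofinal_along l A r g"
    and k: "Card_order k" and l: "Card_order l" "regularCard l" and kl: "k <o l"
  shows False
proof -
  have fg: "f ` Field k \<subseteq> A" "g ` Field l \<subseteq> A"
    using f g by (auto simp: cofinal_along_def)
  then have "\<forall>i \<in> Field k. \<exists>j \<in> Field l. \<forall>j'. (j, j') \<in> l \<longrightarrow> (f i, g j') \<in> r"
    using g by (auto simp: cofinal_along_def)
  then obtain b where b: "\<And>i. i \<in> Field k \<Longrightarrow> b i \<in> Field l"
      "\<And>i j. i \<in> Field k \<Longrightarrow> (b i, j) \<in> l \<Longrightarrow> (f i, g j) \<in> r"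
    by metis
  have "|b ` Field k| \<le>o |Field k|"
    by (rule card_of_image)
  moreover have "|Field k| =o k"
    using k by (rule card_of_Field_ordIso)
  ultimately have "|b ` Field k| <o l"
    using kl ordLeq_ordIso_trans ordLeq_ordLess_trans by blast
  then obtain j where j: "j \<in> Field l" "\<forall>i \<in> Field k. (b i, j) \<in> l"
    using regularCard_bounded[OF l, of "b ` Field k"] b(1) by blast
  then have "g j \<in> A"
    using fg by blast
  then obtain i where "i \<in> Field k" "\<forall>i'. (i, i') \<in> k \<longrightarrow> (g j, f i') \<in> r"
    using f unfolding cofinal_along_def by blast
  then have "i \<in> Field k" "(g j, f i) \<in> r"
    using Card_orderD(1)[OF k] by auto
  moreover from this j have "(f i, g j) \<in> r"
    using b(2) by blast
  ultimately show False
    using asym j(1) fg by blast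
qed

section \<open>Ultrapowers of orders\<close>

text \<open>The order symbol of the ultrapower as a set of pairs, to match
  \<open>cofinal_along\<close>. The type constraint pins the type of function symbols, of which the
  left side shows no trace.\<close>

definition ultrapower_less :: "'i filter \<Rightarrow> 'a set \<Rightarrow> 'a rel \<Rightarrow> ('i \<Rightarrow> 'a) set rel" where
  "ultrapower_less U A r =
    {(X, Y). rel_int (ultrapower (order_struct A r) U :: (_, nat, nat) struct) 0 [X, Y]}"

lemma universe_ultrapower:
  "universe (ultrapower M U) = {x. range x \<subseteq> universe M} // up_rel U (universe M)"
  by (simp add: ultrapower_def)

lemma ultrapower_less_iff:
  assumes "range x \<subseteq> A" "range y \<subseteq> A"
  shows "(up_rel U A `` {x}, up_rel U A `` {y}) \<in> ultrapower_less U A r \<longleftrightarrow>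
    eventually (\<lambda>i. (x i, y i) \<in> r) U"
  using assms rel_int_ultrapower[of "[x, y]" "order_struct A r" U 0]
  by (auto simp: ultrapower_less_def)

text \<open>Opposite comparisons would hold together at some coordinate, because \<open>U\<close> is
  proper.\<close>

lemma ultrapower_less_asym:
  assumes U: "U \<noteq> bot" and r: "dense_order_on A r"
    and XY: "X \<in> {x. range x \<subseteq> A} // up_rel U A" "Y \<in> {x. range x \<subseteq> A} // up_rel U A"
    and less: "(X, Y) \<in> ultrapower_less U A r"
  shows "(Y, X) \<notin> ultrapower_less U A r"
proof
  assume "(Y, X) \<in> ultrapower_less U A r"
  moreover obtain x y where "range x \<subseteq> A" "range y \<subseteq> A"
    "X = up_rel U A `` {x}" "Y = up_rel U A `` {y}"
    using XY by (auto elim!: quotientE)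
  ultimately have "eventually (\<lambda>i. (x i, y i) \<in> r) U" "eventually (\<lambda>i. (y i, x i) \<in> r) U"
    using less by (simp_all add: ultrapower_less_iff)
  then have "eventually (\<lambda>_. False) U"
    by (rule eventually_elim2) (use dense_order_onD(2,3)[OF r] in blast)
  with U show False
    by simp
qed

text \<open>Each coordinate \<open>x n\<close> is exceeded from an index \<open>b n\<close> on, and
  the countably many \<open>b n\<close> have one bound in \<open>k\<close>. Beyond it the comparison
  with the constant sequence holds at every coordinate, hence modulo every filter.\<close>

lemma cofinal_along_ultrapower:
  fixes U :: "nat filter"
  assumes f: "cofinal_along k A r f"
    and k: "Card_order k" "regularCard k" "natLeq <o k"
  shows "cofinal_along k ({x. range x \<subseteq> A} // up_rel U A) (ultrapower_less U A r)
    (\<lambda>i. up_rel U A `` {\<lambda>_. f i})"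
  unfolding cofinal_along_def
proof (intro conjI ballI)
  have fA: "range (\<lambda>_ :: nat. f i) \<subseteq> A" if "i \<in> Field k" for i
    using f that by (auto simp: cofinal_along_def)
  then show "(\<lambda>i. up_rel U A `` {\<lambda>_. f i}) ` Field k \<subseteq> {x. range x \<subseteq> A} // up_rel U A"
    by (auto intro!: quotientI)
  fix X assume "X \<in> {x. range x \<subseteq> A} // up_rel U A"
  then obtain x where x: "range x \<subseteq> A" "X = up_rel U A `` {x}"
    by (auto elim!: quotientE)
  then have "x n \<in> A" for n
    by blast
  then have "\<forall>n. \<exists>i \<in> Field k. \<forall>j. (i, j) \<in> k \<longrightarrow> (x n, f j) \<in> r"
    using f unfolding cofinal_along_def by blast
  then obtain b where b: "\<And>n. b n \<in> Field k" "\<And>n j. (b n, j) \<in> k \<Longrightarrow> (x n, f j) \<in> r"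
    by metis
  have "|range b| \<le>o natLeq"
    using ordLeq_ordIso_trans[OF card_of_image card_of_nat] .
  then have "|range b| <o k"
    using k(3) ordLeq_ordLess_trans by blast
  then obtain i where i: "i \<in> Field k" "\<And>n. (b n, i) \<in> k"
    using regularCard_bounded[OF k(1,2), of "range b"] b(1) by blast
  have "(X, up_rel U A `` {\<lambda>_. f j}) \<in> ultrapower_less U A r" if "(i, j) \<in> k" for j
  proof -
    have "(x n, f j) \<in> r" for n
      using b(2) i(2) that Card_orderD(2)[OF k(1)] by blast
    moreover have "j \<in> Field k"
      using that by (rule FieldI2)
    ultimately show ?thesis
      using x fA by (simp add: ultrapower_less_iff)
  qed
  with i(1) show "\<exists>i \<in> Field k. \<forall>j. (i, j) \<in> k \<longrightarrow>
      (X, up_rel U A `` {\<lambda>_. f j}) \<in> ultrapower_less U A r"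
    by blast
qed

lemma cofinal_along_isomorphic:
  assumes h: "bij_betw h A B" "\<And>x y. x \<in> A \<Longrightarrow> y \<in> A \<Longrightarrow> (x, y) \<in> r \<longleftrightarrow> (h x, h y) \<in> q"
    and f: "cofinal_along k A r f"
  shows "cofinal_along k B q (h \<circ> f)"
  unfolding cofinal_along_def
proof (intro conjI ballI)
  have fA: "f i \<in> A" if "i \<in> Field k" for i
    using f that by (auto simp: cofinal_along_def)
  with h(1) show "(h \<circ> f) ` Field k \<subseteq> B"
    by (auto simp: bij_betw_def)
  fix y assume "y \<in> B"
  with h(1) obtain x where x: "x \<in> A" "y = h x"
    by (auto simp: bij_betw_def)
  then obtain i where "i \<in> Field k" "\<forall>j. (i, j) \<in> k \<longrightarrow> (x, f j) \<in> r"
    using f unfolding cofinal_along_def by blast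
  with x h(2) fA show "\<exists>i \<in> Field k. \<forall>j. (i, j) \<in> k \<longrightarrow> (y, (h \<circ> f) j) \<in> q"
    by (metis FieldI2 comp_apply)
qed

text \<open>An isomorphism would carry the diagonal chain of length \<open>k\<close> into the
  ultrapower of \<open>B\<close>, which has a diagonal chain of length \<open>l\<close>
  already.\<close>

lemma ultrapowers_not_isomorphic:
  fixes U :: "nat filter" and A :: "'a set" and B :: "'b set"
  assumes U: "U \<noteq> bot" and B: "dense_order_on B q"
    and f: "cofinal_along k A r f" and g: "cofinal_along l B q g"
    and k: "Card_order k" "regularCard k" "natLeq <o k"
    and l: "Card_order l" "regularCard l" "k <o l"
  shows "\<not> isomorphic (order_language :: (nat, nat) language)
    (ultrapower (order_struct A r) U) (ultrapower (order_struct B q) U)"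
proof
  let ?A = "{x. range x \<subseteq> A} // up_rel U A" and ?B = "{x. range x \<subseteq> B} // up_rel U B"
  let ?f = "\<lambda>i. up_rel U A `` {\<lambda>_. f i}" and ?g = "\<lambda>i. up_rel U B `` {\<lambda>_. g i}"
  assume "isomorphic (order_language :: (nat, nat) language)
    (ultrapower (order_struct A r) U) (ultrapower (order_struct B q) U)"
  then obtain h where h: "bij_betw h ?A ?B"
    and rel: "\<And>xs. xs \<in> lists ?A \<Longrightarrow> length xs = 2 \<Longrightarrow>
      rel_int (ultrapower (order_struct A r) U :: (_, nat, nat) struct) 0 xs \<longleftrightarrow>
      rel_int (ultrapower (order_struct B q) U :: (_, nat, nat) struct) 0 (map h xs)"
    unfolding isomorphic_def by (auto simp: universe_ultrapower)
  have less: "(X, Y) \<in> ultrapower_less U A r \<longleftrightarrow> (h X, h Y) \<in> ultrapower_less U B q"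
    if "X \<in> ?A" "Y \<in> ?A" for X Y
    using rel[of "[X, Y]"] that by (simp add: ultrapower_less_def)
  have "natLeq <o l"
    using k(3) l(3) by (rule ordLess_transitive)
  then have "cofinal_along l ?B (ultrapower_less U B q) ?g"
    by (rule cofinal_along_ultrapower[OF g l(1,2)])
  moreover have "cofinal_along k ?B (ultrapower_less U B q) (h \<circ> ?f)"
    using cofinal_along_isomorphic[OF h less cofinal_along_ultrapower[OF f k]] .
  ultimately show False
    using no_cofinal_chains_of_distinct_length[OF ultrapower_less_asym[OF U B]] k(1) l by blast
qed

section \<open>Dense orders of prescribed cofinality\<close>

text \<open>The rational factor of the lexicographic product gives density and removes endpoints;
  the well-order \<open>k\<close> gives the cofinality. The product is copied into \<open>'a\<close>
  along an injection, as both structures of the criterion share this type.\<close>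

lemma dense_order_of_cofinality:
  assumes k: "Cinfinite k" "k \<le>o |UNIV :: 'a set|"
  obtains A :: "'a set" and r f where
    "dense_order_on A r" "cofinal_along k A r f" "|A| \<le>o k"
proof -
  let ?S = "Field k \<times> (UNIV :: rat set)"
  \<comment> \<open>Cardinals are reflexive well-orders; removing \<open>Id\<close> makes the first
    factor strict.\<close>
  let ?lex = "(k - Id) <*lex*> {(p :: rat, p'). p < p'}"
  have card: "Card_order k" and inf: "infinite (Field k)"
    using k(1) by (auto simp: cinfinite_def)
  have "|UNIV :: rat set| \<le>o natLeq"
    by (simp add: countable_card_le_natLeq[symmetric])
  then have "|UNIV :: rat set| \<le>o k"
    using natLeq_ordLeq_cinfinite[OF k(1)] by (rule ordLeq_transitive)
  moreover have "|Field k| \<le>o k"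
    using card_of_Field_ordIso[OF card] by (rule ordIso_imp_ordLeq)
  ultimately have size: "|?S| \<le>o k"
    using card_of_Times_ordLeq_infinite_Field[OF inf _ _ card] by blast
  then have "|?S| \<le>o |UNIV :: 'a set|"
    using k(2) by (rule ordLeq_transitive)
  then obtain e :: "_ \<times> rat \<Rightarrow> 'a" where e: "inj_on e ?S"
    unfolding card_of_ordLeq[symmetric] by blast
  define A where "A = e ` ?S"
  define d where "d = inv_into ?S e"
  \<comment> \<open>As a pullback, \<open>r\<close> is transitive and irreflexive on the whole type;
    it is total on \<open>A\<close>, where \<open>d\<close> inverts \<open>e\<close>.\<close>
  define r where "r = inv_image ?lex d"
  have d: "d (e x) = x" if "x \<in> ?S" for x
    unfolding d_def using e that by (rule inv_into_f_f)
  have ex: "(\<exists>z \<in> A. P (d z)) \<longleftrightarrow> (\<exists>z \<in> ?S. P z)" for P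
    using d by (auto simp: A_def)
  have lin: "strict_linear_order_on (Field k) (k - Id)"
    using card by (auto simp: card_order_on_def well_order_on_def
        intro: strict_linear_order_on_diff_Id)
  have limit: "\<exists>j \<in> Field k. (i, j) \<in> k - Id" if "i \<in> Field k" for i
    using infinite_Card_order_limit[OF card inf that] by auto
  have "trans (k - Id)" and tot: "total_on (Field k) (k - Id)"
    using lin by (simp_all add: strict_linear_order_on_def)
  moreover have "trans {(p :: rat, p'). p < p'}"
    by (auto intro: transI)
  ultimately have "trans ?lex"
    by (intro trans_lex_prod)
  then have "trans r"
    unfolding r_def by (rule trans_inv_image)
  moreover have "irrefl ?lex"
    by (simp add: irrefl_def)
  then have "irrefl r"
    unfolding irrefl_def r_def in_inv_image by blast
  moreover have "total_on ?S ?lex"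
    using tot by (intro total_on_lex_prod) (auto simp: total_on_def)
  then have "total_on A r"
    unfolding total_on_def r_def A_def in_inv_image by (metis d image_iff)
  ultimately have "strict_linear_order_on A r"
    by (simp add: strict_linear_order_on_def)
  moreover have "A \<noteq> {}"
    using inf by (auto simp: A_def)
  moreover have "\<exists>z \<in> A. (x, z) \<in> r \<and> (z, y) \<in> r"
    if xy: "x \<in> A" "y \<in> A" "(x, y) \<in> r" for x y
  proof -
    obtain i p j p' where x: "d x = (i, p)" and y: "d y = (j, p')" and "i \<in> Field k" "j \<in> Field k"
      using xy(1,2) d by (auto simp: A_def)
    have "\<exists>z \<in> ?S. ((i, p), z) \<in> ?lex \<and> (z, (j, p')) \<in> ?lex"
    proof (cases "i = j")
      case True
      with x y xy(3) have "p < p'"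
        by (auto simp: r_def)
      then obtain p'' where "p < p''" "p'' < p'"
        using dense by blast
      with True \<open>i \<in> Field k\<close> show ?thesis
        by (intro bexI[of _ "(i, p'')"]) auto
    next
      case False
      \<comment> \<open>The copy of the rationals at \<open>i\<close> lies wholly below the copy at
        \<open>j\<close>, so moving up inside the former stays between.\<close>
      with x y xy(3) \<open>i \<in> Field k\<close> show ?thesis
        by (intro bexI[of _ "(i, p + 1)"]) (auto simp: r_def)
    qed
    then show ?thesis
      using ex[of "\<lambda>z. (d x, z) \<in> ?lex \<and> (z, d y) \<in> ?lex"] x y by (simp add: r_def)
  qed
  moreover have "(\<exists>y \<in> A. (y, x) \<in> r) \<and> (\<exists>y \<in> A. (x, y) \<in> r)"
    if "x \<in> A" for x
  proof -
    obtain i p where x: "d x = (i, p)" "i \<in> Field k"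
      using \<open>x \<in> A\<close> d by (auto simp: A_def)
    \<comment> \<open>Both moves stay inside one copy of the rationals, since \<open>i\<close> may
      be the least index.\<close>
    then have "(\<exists>y \<in> ?S. (y, d x) \<in> ?lex) \<and> (\<exists>y \<in> ?S. (d x, y) \<in> ?lex)"
      by (intro conjI bexI[of _ "(i, p - 1)"] bexI[of _ "(i, p + 1)"]) auto
    then show ?thesis
      using ex[of "\<lambda>y. (y, d x) \<in> ?lex"] ex[of "\<lambda>y. (d x, y) \<in> ?lex"] by (simp add: r_def)
  qed
  ultimately have "dense_order_on A r"
    unfolding dense_order_on_def by blast
  moreover have "cofinal_along k A r (\<lambda>i. e (i, 0))"
    unfolding cofinal_along_def
  proof (intro conjI ballI)
    show "(\<lambda>i. e (i, 0)) ` Field k \<subseteq> A"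
      by (auto simp: A_def)
    fix x assume "x \<in> A"
    then obtain i p where x: "d x = (i, p)" "i \<in> Field k"
      using d by (auto simp: A_def)
    \<comment> \<open>An index strictly above \<open>i\<close> is taken so that
      \<open>(l, 0)\<close> exceeds \<open>(i, p)\<close> for every \<open>l\<close> from
      \<open>j\<close> on, however large \<open>p\<close> is.\<close>
    then obtain j where j: "j \<in> Field k" "(i, j) \<in> k - Id"
      using limit by blast
    have "(x, e (l, 0)) \<in> r" if "(j, l) \<in> k" for l
    proof -
      have "l \<in> Field k"
        using that by (rule FieldI2)
      moreover have "(i, l) \<in> k - Id"
      proof (cases "j = l")
        case False
        with that have "(j, l) \<in> k - Id" by simp
        with j(2) lin show ?thesis
          unfolding strict_linear_order_on_def by (blast dest: transD)
      qed (use j in simp)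
      ultimately show ?thesis
        using x d by (simp add: r_def)
    qed
    with j(1) show "\<exists>i \<in> Field k. \<forall>j. (i, j) \<in> k \<longrightarrow> (x, e (j, 0)) \<in> r"
      by blast
  qed
  moreover have "|A| \<le>o k"
    unfolding A_def using card_of_image size by (rule ordLeq_transitive)
  ultimately show thesis
    by (rule that)
qed

section \<open>Refutation of the criterion by orders of cofinality \<open>\<aleph>\<^sub>1\<close>
  and \<open>\<aleph>\<^sub>2\<close>\<close>

theorem theorem1p1:
  assumes "cardSuc (cardSuc natLeq) \<le>o ctwo ^c natLeq"
    and "ctwo ^c natLeq \<le>o |UNIV :: 'a set|"
  shows "\<not> (\<forall>(L :: (nat, nat) language) (M :: ('a, nat, nat) struct) (N :: ('a, nat, nat) struct).
    countable_language L \<longrightarrow> is_struct L M \<longrightarrow> is_struct L N \<longrightarrow>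
    |universe M| \<le>o ctwo ^c natLeq \<longrightarrow> |universe N| \<le>o ctwo ^c natLeq \<longrightarrow>
    (elem_equiv L M N \<longleftrightarrow>
      (\<exists>U :: nat filter. ultrafilter U \<and> isomorphic L (ultrapower M U) (ultrapower N U))))"
proof
  let ?k = "cardSuc natLeq" and ?l = "cardSuc (cardSuc natLeq)"
  assume crit: "\<forall>(L :: (nat, nat) language) (M :: ('a, nat, nat) struct)
      (N :: ('a, nat, nat) struct).
    countable_language L \<longrightarrow> is_struct L M \<longrightarrow> is_struct L N \<longrightarrow>
    |universe M| \<le>o ctwo ^c natLeq \<longrightarrow> |universe N| \<le>o ctwo ^c natLeq \<longrightarrow>
    (elem_equiv L M N \<longleftrightarrow>
      (\<exists>U :: nat filter. ultrafilter U \<and> isomorphic L (ultrapower M U) (ultrapower N U)))"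
  have cinf: "Cinfinite natLeq" "Cinfinite ?k" "Cinfinite ?l"
    by (rule natLeq_Cinfinite Cinfinite_cardSuc)+
  \<comment> \<open>Successors of infinite cardinals are regular.\<close>
  then have k: "Card_order ?k" "regularCard ?k" "natLeq <o ?k"
    and l: "Card_order ?l" "regularCard ?l" "?k <o ?l"
    by (auto intro: cardSuc_Card_order regularCard_cardSuc cardSuc_greater)
  \<comment> \<open>The hypothesis on the continuum enters as a size bound: both orders fit into
    \<open>'a\<close> and are small enough for the criterion.\<close>
  have k2: "?k \<le>o ctwo ^c natLeq"
    using ordLess_imp_ordLeq[OF l(3)] assms(1) by (rule ordLeq_transitive)
  obtain A :: "'a set" and r f where A: "dense_order_on A r" "cofinal_along ?k A r f" "|A| \<le>o ?k"
    using dense_order_of_cofinality[OF cinf(2) ordLeq_transitive[OF k2 assms(2)]] by metis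
  obtain B :: "'a set" and q g where B: "dense_order_on B q" "cofinal_along ?l B q g" "|B| \<le>o ?l"
    using dense_order_of_cofinality[OF cinf(3) ordLeq_transitive[OF assms]] by metis
  let ?L = "order_language :: (nat, nat) language"
  let ?M = "order_struct A r :: ('a, nat, nat) struct"
  let ?N = "order_struct B q :: ('a, nat, nat) struct"
  have "countable_language ?L" "is_struct ?L ?M" "is_struct ?L ?N"
    using dense_order_onD(1)[OF A(1)] dense_order_onD(1)[OF B(1)]
    by (auto simp: countable_language_def is_struct_def)
  moreover have "|universe ?M| \<le>o ctwo ^c natLeq" "|universe ?N| \<le>o ctwo ^c natLeq"
    using ordLeq_transitive[OF A(3) k2] ordLeq_transitive[OF B(3) assms(1)] by simp_all
  moreover have "elem_equiv ?L ?M ?N"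
    using elem_equiv_dense_orders[OF A(1) B(1)] .
  \<comment> \<open>The direction of the criterion that fails is the one from elementary equivalence
    to isomorphic ultrapowers.\<close>
  ultimately have "\<exists>U :: nat filter. ultrafilter U \<and>
      isomorphic ?L (ultrapower ?M U) (ultrapower ?N U)"
    using crit[rule_format, of ?L ?M ?N] by blast
  then obtain U :: "nat filter" where "U \<noteq> bot"
      "isomorphic ?L (ultrapower ?M U) (ultrapower ?N U)"
    by (auto simp: ultrafilter_def)
  then show False
    using ultrapowers_not_isomorphic[OF _ B(1) A(2) B(2) k l] by blast
qed

end
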